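(* Let $g_1,g_2\ge 2$ be integers, $a_1<b_1$, $a_2<b_2$ real numbers, and let $\mathbf u=(u_1,u_2)\in\mathbb R^2$ with $u_1\le a_1$ and $u_2\le a_2$. For nodes $a_1\le x_0<\dots<x_{g_1-1}\le b_1$ and $a_2\le y_0<\dots<y_{g_2-1}\le b_2$, let $$l_{i_1i_2}(x,y)=\prod_{h\ne i_1}\frac{x-x_h}{x_{i_1}-x_h}\ \prod_{h\ne i_2}\frac{y-y_h}{y_{i_2}-y_h},\qquad 0\le i_1\le g_1-1,\ 0\le i_2\le g_2-1,$$ be the bivariate elementary Lagrange polynomials of the grid $\{(x_{i_1},y_{i_2})\}$. Then the minimum, over all such choices of nodes, of $$\sum_{i_1=0}^{g_1-1}\sum_{i_2=0}^{g_2-1}\left|l_{i_1i_2}(\mathbf u)\right|$$ is attained at $x_{i_1}=s_1^*(i_1)$, $y_{i_2}=s_2^*(i_2)$, where $$s_j^*(i_j)=\frac{a_j+b_j}{2}+\frac{b_j-a_j}{2}\cos\left(\frac{g_j-1-i_j}{g_j-1}\pi\right),\qquad i_j=0,\dots,g_j-1,\ j=1,2.$$ *)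

theory Defs
  imports Complex_Main
begin

(* Grid nodes are functions nat => real of which only the values at indices < g matter. *)

definition elementary_lagrange ::
  "nat \<Rightarrow> nat \<Rightarrow> (nat \<Rightarrow> real) \<Rightarrow> (nat \<Rightarrow> real) \<Rightarrow> nat \<Rightarrow> nat \<Rightarrow> real \<times> real \<Rightarrow> real"
  where
  "elementary_lagrange g1 g2 x y i1 i2 p =
     (\<Prod>h\<in>{..<g1} - {i1}. (fst p - x h) / (x i1 - x h)) *
     (\<Prod>h\<in>{..<g2} - {i2}. (snd p - y h) / (y i2 - y h))"

definition admissible_nodes :: "nat \<Rightarrow> real \<Rightarrow> real \<Rightarrow> (nat \<Rightarrow> real) \<Rightarrow> bool" where
  "admissible_nodes g a b x \<longleftrightarrow>
     (\<forall>i<g. a \<le> x i \<and> x i \<le> b) \<and> strict_mono_on {..<g} x"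

definition chebyshev_node :: "nat \<Rightarrow> real \<Rightarrow> real \<Rightarrow> nat \<Rightarrow> real" where
  "chebyshev_node g a b i =
     (a + b) / 2 + (b - a) / 2 * cos ((real g - 1 - real i) / (real g - 1) * pi)"

end

theory Submission
  imports Defs "HOL-Computational_Algebra.Polynomial"
begin

text \<open>
  The bivariate sum factors into two univariate ones. In one variable, let \<open>T\<close> be the
  Chebyshev polynomial of degree \<open>g - 1\<close> transported to \<open>[a, b]\<close>. Interpolating it at
  arbitrary nodes and using \<open>\<bar>T\<bar> \<le> 1\<close> on \<open>[a, b]\<close> gives
  \<open>\<bar>T(u)\<bar> \<le> (\<Sum>i. \<bar>l\<^sub>i(u)\<bar>)\<close>. At the Chebyshev extrema both \<open>T\<close> and, because \<open>u\<close>
  lies to the left of all nodes, \<open>l\<^sub>i(u)\<close> alternate in sign, so equality holds there.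
\<close>

fun chebyshev_poly :: "nat \<Rightarrow> real poly" where
  "chebyshev_poly 0 = 1"
| "chebyshev_poly (Suc 0) = [:0, 1:]"
| "chebyshev_poly (Suc (Suc n)) = [:0, 2:] * chebyshev_poly (Suc n) - chebyshev_poly n"

lemma degree_chebyshev_poly_le: "degree (chebyshev_poly n) \<le> n"
proof (induction n rule: chebyshev_poly.induct)
  case (3 n)
  have "degree ([:0, 2:] * chebyshev_poly (Suc n)) \<le> Suc (Suc n)"
    using degree_mult_le[of "[:0, 2:]" "chebyshev_poly (Suc n)"] 3 by simp
  then show ?case
    using 3 by (auto intro!: degree_diff_le)
qed auto

lemma poly_chebyshev_poly_cos: "poly (chebyshev_poly n) (cos t) = cos (real n * t)"
proof (induction n rule: chebyshev_poly.induct)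
  case (3 n)
  have "cos (real (Suc (Suc n)) * t) + cos (real n * t) = 2 * cos t * cos (real (Suc n) * t)"
    using cos_times_cos[of "real (Suc n) * t" t] by (simp add: algebra_simps)
  with 3 show ?case by simp
qed auto

lemma abs_poly_chebyshev_poly_le_1:
  assumes "\<bar>x\<bar> \<le> 1"
  shows "\<bar>poly (chebyshev_poly n) x\<bar> \<le> 1"
proof -
  have "x = cos (arccos x)" using assms by (simp add: cos_arccos_abs)
  then show ?thesis by (metis poly_chebyshev_poly_cos abs_cos_le_one)
qed

text \<open>One coordinate of \<open>elementary_lagrange\<close>, so that a single univariate theory
  serves both axes.\<close>

definition lagrange_factor :: "nat \<Rightarrow> (nat \<Rightarrow> real) \<Rightarrow> nat \<Rightarrow> real \<Rightarrow> real" where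
  "lagrange_factor g x i t = (\<Prod>h\<in>{..<g} - {i}. (t - x h) / (x i - x h))"

text \<open>Both sides are polynomials in \<open>t\<close> of degree below \<open>g\<close> that
  agree at \<open>g\<close> distinct nodes.\<close>

lemma lagrange_interpolation:
  fixes p :: "real poly"
  assumes inj: "inj_on x {..<g}" and deg: "degree p < g"
  shows "poly p t = (\<Sum>i<g. poly p (x i) * lagrange_factor g x i t)"
proof -
  \<comment> \<open>The factors are rebuilt as objects of type \<open>real poly\<close>, so that
    degrees can be bounded and the identity theorem applied.\<close>
  define l where "l i = (\<Prod>h\<in>{..<g} - {i}. smult (1 / (x i - x h)) [:- x h, 1:])" for i
  have poly_l: "poly (l i) s = lagrange_factor g x i s" for i s
    by (simp add: l_def lagrange_factor_def poly_prod diff_divide_distrib)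
  define q where "q = (\<Sum>i<g. smult (poly p (x i)) (l i))"
  have poly_q: "poly q s = (\<Sum>i<g. poly p (x i) * lagrange_factor g x i s)" for s
    by (simp add: q_def poly_sum poly_l)
  have "degree (l i) \<le> g - 1" if "i < g" for i
  proof -
    have "degree (l i) \<le> (\<Sum>h\<in>{..<g} - {i}. degree (smult (1 / (x i - x h)) [:- x h, 1:]))"
      unfolding l_def by (rule order_trans[OF degree_prod_sum_le]) auto
    also have "\<dots> \<le> (\<Sum>h\<in>{..<g} - {i}. 1)"
      by (rule sum_mono) simp
    finally show ?thesis using that by simp
  qed
  then have "degree q \<le> g - 1"
    unfolding q_def by (auto intro!: degree_sum_le order_trans[OF degree_smult_le])
  \<comment> \<open>Strictness needs \<open>g\<close> to be positive, which \<open>deg\<close>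
    supplies.\<close>
  with deg have deg_q: "degree q < g" by linarith
  have node: "lagrange_factor g x i (x j) = (if i = j then 1 else 0)" if "i < g" "j < g" for i j
  proof (cases "i = j")
    case True
    have "lagrange_factor g x i (x j) = (\<Prod>h\<in>{..<g} - {i}. 1)"
      unfolding lagrange_factor_def using inj that True
      by (intro prod.cong) (auto simp: inj_on_def)
    with True show ?thesis by simp
  next
    case False
    with that show ?thesis by (auto simp: lagrange_factor_def intro!: prod_zero)
  qed
  have "p = q"
  proof (rule poly_eqI_degree[where A = "x ` {..<g}"])
    fix s assume "s \<in> x ` {..<g}"
    then obtain j where j: "j < g" "s = x j" by auto
    have "poly q s = (\<Sum>i<g. if i = j then poly p (x i) else 0)"
      unfolding poly_q j(2) using j(1) by (intro sum.cong) (auto simp: node)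
    then show "poly p s = poly q s" using j by simp
  qed (use deg deg_q inj in \<open>auto simp: card_image\<close>)
  then have "poly p t = poly q t" by (rule arg_cong)
  then show ?thesis unfolding poly_q .
qed

text \<open>Each of the \<open>i\<close> nodes below \<open>x i\<close> gives a quotient with
  nonpositive numerator and positive denominator, hence one sign; for nodes above \<open>x i\<close>
  both are nonpositive and no sign arises. The inequality is weak because \<open>t\<close> may
  coincide with a node.\<close>

lemma lagrange_factor_alternates:
  assumes mono: "strict_mono_on {..<g} x" and left: "\<And>i. i < g \<Longrightarrow> t \<le> x i" and "i < g"
  shows "0 \<le> (- 1) ^ i * lagrange_factor g x i t"
proof -
  have less: "x h < x k" if "h < k" "k < g" for h k
    using mono that by (auto simp: strict_mono_on_def)
  have split: "{..<g} - {i} = {..<i} \<union> {i<..<g}" using \<open>i < g\<close> by auto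
  have "lagrange_factor g x i t =
      (\<Prod>h<i. (t - x h) / (x i - x h)) * (\<Prod>h\<in>{i<..<g}. (t - x h) / (x i - x h))"
    unfolding lagrange_factor_def split by (rule prod.union_disjoint) auto
  moreover have "(- 1) ^ i * (\<Prod>h<i. (t - x h) / (x i - x h)) = (\<Prod>h<i. (x h - t) / (x i - x h))"
  proof -
    have "(\<Prod>h<i. (x h - t) / (x i - x h)) = (\<Prod>h<i. - 1 * ((t - x h) / (x i - x h)))"
      by (intro prod.cong refl) (simp flip: minus_divide_left)
    also have "\<dots> = (- 1) ^ i * (\<Prod>h<i. (t - x h) / (x i - x h))"
      unfolding prod.distrib by simp
    finally show ?thesis ..
  qed
  ultimately have "(- 1) ^ i * lagrange_factor g x i t =
      (\<Prod>h<i. (x h - t) / (x i - x h)) * (\<Prod>h\<in>{i<..<g}. (t - x h) / (x i - x h))"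
    by (simp only: mult.assoc[symmetric])
  also have "\<dots> \<ge> 0"
    using less left \<open>i < g\<close>
    by (intro mult_nonneg_nonneg prod_nonneg ballI divide_nonneg_pos divide_nonpos_neg)
       (auto intro: less_trans)
  finally show ?thesis .
qed

text \<open>Feasibility of the claimed minimiser. The angles decrease from pi to 0 as the index
  grows, and cosine is strictly decreasing there, so the nodes increase.\<close>

lemma admissible_nodes_chebyshev_node:
  assumes "g \<ge> 2" and "a < b"
  shows "admissible_nodes g a b (chebyshev_node g a b)"
  unfolding admissible_nodes_def
proof (intro conjI allI impI)
  fix i
  define c where "c = cos ((real g - 1 - real i) / (real g - 1) * pi)"
  have "(b - a) / 2 * (- 1) \<le> (b - a) / 2 * c" "(b - a) / 2 * c \<le> (b - a) / 2 * 1"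
    unfolding c_def using assms by (intro mult_left_mono; simp)+
  then show "a \<le> chebyshev_node g a b i" "chebyshev_node g a b i \<le> b"
    unfolding chebyshev_node_def c_def[symmetric] by argo+
next
  show "strict_mono_on {..<g} (chebyshev_node g a b)"
  proof (rule strict_mono_onI)
    fix i j assume *: "i \<in> {..<g}" "j \<in> {..<g}" "i < j"
    define s where "s k = (real g - 1 - real k) / (real g - 1) * pi" for k
    have g: "real g - 1 > 0" using assms by linarith
    have "0 \<le> s j" using * g by (auto simp: s_def)
    moreover have "s j < s i"
      unfolding s_def using * g by (intro mult_strict_right_mono divide_strict_right_mono) auto
    moreover have "s i \<le> pi"
    proof -
      have "(real g - 1 - real i) / (real g - 1) \<le> 1" using g by simp
      then show ?thesis unfolding s_def using pi_gt_zero
        by (metis mult_right_mono mult_1 less_imp_le)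
    qed
    ultimately have "cos (s i) < cos (s j)" by (rule cos_monotone_0_pi)
    then show "chebyshev_node g a b i < chebyshev_node g a b j"
      unfolding chebyshev_node_def s_def[symmetric] using assms by simp
  qed
qed

text \<open>The inner affine polynomial maps [a, b] onto [-1, 1]. The two claims are proved together
  because they share \<open>T\<close>: its value at \<open>t\<close> does not depend on the nodes
  and so links arbitrary grids to the Chebyshev one. Only the equality needs \<open>t\<close> to lie
  left of the interval.\<close>

lemma
  fixes g :: nat and a b t :: real
  assumes g: "g \<ge> 2" and ab: "a < b"
  defines "T \<equiv> chebyshev_poly (g - 1) \<circ>\<^sub>p [:- (a + b) / (b - a), 2 / (b - a):]"
  shows abs_poly_le_sum_lagrange_factor:
    "admissible_nodes g a b x \<Longrightarrow> \<bar>poly T t\<bar> \<le> (\<Sum>i<g. \<bar>lagrange_factor g x i t\<bar>)"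
    and sum_lagrange_factor_chebyshev_node:
    "t \<le> a \<Longrightarrow> (\<Sum>i<g. \<bar>lagrange_factor g (chebyshev_node g a b) i t\<bar>) = \<bar>poly T t\<bar>"
proof -
  have "degree T \<le> degree (chebyshev_poly (g - 1))"
    using degree_pcompose_le[of "chebyshev_poly (g - 1)" "[:- (a + b) / (b - a), 2 / (b - a):]"]
      ab by (simp add: T_def)
  then have deg: "degree T < g"
    using degree_chebyshev_poly_le[of "g - 1"] g by linarith
  have poly_T: "poly T s = poly (chebyshev_poly (g - 1)) ((2 * s - (a + b)) / (b - a))" for s
    by (simp add: T_def poly_pcompose diff_divide_distrib add_divide_distrib algebra_simps)
  have inj: "inj_on x {..<g}" if "admissible_nodes g a b x" for x
    using that by (auto simp: admissible_nodes_def intro: strict_mono_on_imp_inj_on)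
  {
    assume x: "admissible_nodes g a b x"
    have "\<bar>poly T t\<bar> = \<bar>\<Sum>i<g. poly T (x i) * lagrange_factor g x i t\<bar>"
      by (rule arg_cong[OF lagrange_interpolation[OF inj[OF x] deg]])
    also have "\<dots> \<le> (\<Sum>i<g. \<bar>poly T (x i) * lagrange_factor g x i t\<bar>)"
      by (rule sum_abs)
    also have "\<dots> \<le> (\<Sum>i<g. \<bar>lagrange_factor g x i t\<bar>)"
    proof (rule sum_mono)
      fix i assume "i \<in> {..<g}"
      then have "\<bar>(2 * x i - (a + b)) / (b - a)\<bar> \<le> 1"
        using x ab by (auto simp: admissible_nodes_def abs_le_iff field_simps)
      then have "\<bar>poly T (x i)\<bar> \<le> 1"
        unfolding poly_T by (rule abs_poly_chebyshev_poly_le_1)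
      then show "\<bar>poly T (x i) * lagrange_factor g x i t\<bar> \<le> \<bar>lagrange_factor g x i t\<bar>"
        by (simp add: abs_mult mult_left_le_one_le)
    qed
    finally show "\<bar>poly T t\<bar> \<le> (\<Sum>i<g. \<bar>lagrange_factor g x i t\<bar>)" .
  next
    assume t: "t \<le> a"
    let ?s = "chebyshev_node g a b"
    have s: "admissible_nodes g a b ?s"
      using g ab by (rule admissible_nodes_chebyshev_node)
    have val: "poly T (?s i) = (- 1) ^ (g - 1) * (- 1) ^ i" if "i < g" for i
    proof -
      have "(2 * ?s i - (a + b)) / (b - a) = cos (real (g - 1 - i) / real (g - 1) * pi)"
        using g ab that by (simp add: chebyshev_node_def field_simps of_nat_diff)
      \<comment> \<open>Multiplying the angle by the degree \<open>g - 1\<close> cancels its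
        denominator, which is nonzero as \<open>g\<close> is at least 2, and leaves an integer
        multiple of pi.\<close>
      then have "poly T (?s i) = cos (real (g - 1) * (real (g - 1 - i) / real (g - 1) * pi))"
        by (simp only: poly_T poly_chebyshev_poly_cos)
      also have "\<dots> = (- 1) ^ (g - 1 - i)" using g by (simp add: cos_npi)
      \<comment> \<open>Adding an even number to the exponent removes the truncated subtraction, so
        a sign independent of \<open>i\<close> splits off.\<close>
      also have "\<dots> = (- 1) ^ (g - 1 - i + (i + i))" by (simp add: power_add)
      also have "g - 1 - i + (i + i) = g - 1 + i" using that by simp
      also have "(- 1) ^ (g - 1 + i) = ((- 1) ^ (g - 1) * (- 1) ^ i :: real)"
        by (rule power_add)
      finally show ?thesis .
    qed
    have nonneg: "0 \<le> (- 1) ^ i * lagrange_factor g ?s i t" if "i < g" for i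
      using s t that
      by (intro lagrange_factor_alternates) (auto simp: admissible_nodes_def intro: order_trans)
    have abs_eq: "\<bar>lagrange_factor g ?s i t\<bar> = (- 1) ^ i * lagrange_factor g ?s i t" if "i < g" for i
      using abs_of_nonneg[OF nonneg[OF that]] by (simp add: abs_mult)
    have "poly T t = (\<Sum>i<g. poly T (?s i) * lagrange_factor g ?s i t)"
      by (rule lagrange_interpolation[OF inj[OF s] deg])
    \<comment> \<open>The sign \<open>(- 1) ^ i\<close> of the nodal value turns each factor into
      its absolute value, so nothing cancels in the sum.\<close>
    also have "\<dots> = (- 1) ^ (g - 1) * (\<Sum>i<g. \<bar>lagrange_factor g ?s i t\<bar>)"
      unfolding sum_distrib_left by (intro sum.cong) (simp_all add: val abs_eq)
    finally show "(\<Sum>i<g. \<bar>lagrange_factor g ?s i t\<bar>) = \<bar>poly T t\<bar>"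
      by (simp add: abs_mult sum_nonneg)
  }
qed

lemma sum_lagrange_factor_chebyshev_node_le:
  assumes "g \<ge> 2" and "a < b" and "t \<le> a" and "admissible_nodes g a b x"
  shows "(\<Sum>i<g. \<bar>lagrange_factor g (chebyshev_node g a b) i t\<bar>) \<le>
    (\<Sum>i<g. \<bar>lagrange_factor g x i t\<bar>)"
  using sum_lagrange_factor_chebyshev_node[OF assms(1,2,3)]
    abs_poly_le_sum_lagrange_factor[OF assms(1,2,4), of t] by simp

lemma sum_abs_elementary_lagrange:
  "(\<Sum>i1<g1. \<Sum>i2<g2. \<bar>elementary_lagrange g1 g2 x y i1 i2 p\<bar>) =
    (\<Sum>i<g1. \<bar>lagrange_factor g1 x i (fst p)\<bar>) * (\<Sum>i<g2. \<bar>lagrange_factor g2 y i (snd p)\<bar>)"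
  by (simp only: elementary_lagrange_def lagrange_factor_def[symmetric] abs_mult sum_product)

theorem mainTheorem3:
  fixes g1 g2 :: nat and a1 b1 a2 b2 :: real and u :: "real \<times> real"
  assumes "g1 \<ge> 2" and "g2 \<ge> 2"
    and "a1 < b1" and "a2 < b2"
    and "fst u \<le> a1" and "snd u \<le> a2"
  shows "is_arg_min
           (\<lambda>(x, y). \<Sum>i1<g1. \<Sum>i2<g2. \<bar>elementary_lagrange g1 g2 x y i1 i2 u\<bar>)
           (\<lambda>(x, y). admissible_nodes g1 a1 b1 x \<and> admissible_nodes g2 a2 b2 y)
           (chebyshev_node g1 a1 b1, chebyshev_node g2 a2 b2)"
  \<comment> \<open>The constraints on \<open>x\<close> and \<open>y\<close> are independent and
    both factors are nonnegative, so minimising each one separately minimises their product.\<close>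
  unfolding is_arg_min_linorder sum_abs_elementary_lagrange
  using assms
  by (auto intro!: admissible_nodes_chebyshev_node mult_mono
      sum_lagrange_factor_chebyshev_node_le sum_nonneg)

end
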